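(* Let $C$ be a prime modular tensor category (the MTC of a prime TQFT), and let $q\in \mathrm{Gal}(K_C)$. Then the Galois conjugate $q(C)$ is again prime. In other words, the space of prime TQFTs is closed under Galois action.
   Context: A modular tensor category (MTC) $C$ (over $\mathbb{C}$, with finitely many simple objects $a,b,\dots$ called anyons, unit $\mathbf 1$, fusion rules $a\otimes b=\sum_c N_{ab}^c c$) is described, after choosing bases of the fusion spaces $V_{ab}^c$ with $\dim V_{ab}^c=N_{ab}^c$ (such a choice is called a gauge), by its $F$ symbols (associativity matrices), $R$ symbols (braiding matrices) and pivotal coefficients $\epsilon_a\in\{\pm1\}$. There is always a gauge in which all entries of $F$ and $R$ lie in a number field; fix such a gauge. The defining number field $K_C$ is the normal closure over $\mathbb{Q}$ of $\mathbb{Q}(F,R)$. For $q\in\mathrm{Gal}(K_C):=\mathrm{Gal}(K_C/\mathbb{Q})$, the Galois conjugate $q(C)$ is the MTC with the same anyons, the same fusion rules and the same $\epsilon_a$, and with data $q(F),q(R)$. A $2+1$D TQFT is an MTC together with a choice of sign of the total quantum dimension $\mathcal{D}=\pm\sqrt{\sum_a d_a^2}$; Galois actions do not change this choice of sign. An MTC (or its TQFT) is prime if it has no non-trivial proper modular subcategory, i.e. no fusion subcategory other than the trivial one and $C$ itself on which the braiding is non-degenerate; equivalently, it does not factorize as a Deligne product of two non-trivial MTCs. *)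

theory Defs
  imports
    Complex_Main
    "HOL-Algebra.Generated_Fields"
    "HOL-Algebra.Algebraic_Closure_Type"
begin

section \<open>Modular tensor categories in a gauge\<close>

text \<open>
  A modular tensor category is given by its skeletal data. A gauge is a choice of bases
  \<open>v\<^sup>a\<^sup>b\<^sub>c\<^sub>,\<^sub>\<mu>\<close>, \<open>\<mu> < N a b c\<close>, of the fusion spaces \<open>Hom(a \<otimes> b, c)\<close>, with the
  convention that the bases of \<open>Hom(1 \<otimes> a, a)\<close> and \<open>Hom(a \<otimes> 1, a)\<close> are the unit constraints.
  Omitting associators, \<open>F\<close>- and \<open>R\<close>-symbols are defined by

  \<open>v\<^sup>e\<^sup>c\<^sub>d\<^sub>,\<^sub>\<beta> \<circ> (v\<^sup>a\<^sup>b\<^sub>e\<^sub>,\<^sub>\<alpha> \<otimes> id) = (\<Sum>(f,\<mu>,\<nu>). F a b c d (e,\<alpha>,\<beta>) (f,\<mu>,\<nu>) v\<^sup>a\<^sup>f\<^sub>d\<^sub>,\<^sub>\<nu> \<circ> (id \<otimes> v\<^sup>b\<^sup>c\<^sub>f\<^sub>,\<^sub>\<mu>))\<close>,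

  \<open>v\<^sup>b\<^sup>a\<^sub>c\<^sub>,\<^sub>\<mu> \<circ> braiding\<^sub>a\<^sub>,\<^sub>b = (\<Sum>\<nu>. R a b c \<mu> \<nu> v\<^sup>a\<^sup>b\<^sub>c\<^sub>,\<^sub>\<nu>)\<close>.

  Only the values of the components at anyons of the category and at multiplicity indices in
  range are meaningful.
\<close>

record 'a mtc_data =
  anyons :: "'a set"
  vac :: 'a
  dual :: "'a \<Rightarrow> 'a"
  fus :: "'a \<Rightarrow> 'a \<Rightarrow> 'a \<Rightarrow> nat"
  Fsym :: "'a \<Rightarrow> 'a \<Rightarrow> 'a \<Rightarrow> 'a \<Rightarrow> 'a \<times> nat \<times> nat \<Rightarrow> 'a \<times> nat \<times> nat \<Rightarrow> complex"
  Rsym :: "'a \<Rightarrow> 'a \<Rightarrow> 'a \<Rightarrow> nat \<Rightarrow> nat \<Rightarrow> complex"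
  piv :: "'a \<Rightarrow> int"

definition inverse_matrices ::
    "'i set \<Rightarrow> 'j set \<Rightarrow> ('i \<Rightarrow> 'j \<Rightarrow> complex) \<Rightarrow> ('j \<Rightarrow> 'i \<Rightarrow> complex) \<Rightarrow> bool" where
  "inverse_matrices I J M M' \<longleftrightarrow>
     (\<forall>i\<in>I. \<forall>i'\<in>I. (\<Sum>j\<in>J. M i j * M' j i') = of_bool (i = i')) \<and>
     (\<forall>j\<in>J. \<forall>j'\<in>J. (\<Sum>i\<in>I. M' j i * M i j') = of_bool (j = j'))"

definition invertible_matrix :: "'i set \<Rightarrow> 'j set \<Rightarrow> ('i \<Rightarrow> 'j \<Rightarrow> complex) \<Rightarrow> bool" where
  "invertible_matrix I J M \<longleftrightarrow> (\<exists>M'. inverse_matrices I J M M')"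

definition left_trees :: "'a mtc_data \<Rightarrow> 'a \<Rightarrow> 'a \<Rightarrow> 'a \<Rightarrow> 'a \<Rightarrow> ('a \<times> nat \<times> nat) set" where
  "left_trees C a b c d =
     {(e, \<alpha>, \<beta>). e \<in> anyons C \<and> \<alpha> < fus C a b e \<and> \<beta> < fus C e c d}"

definition right_trees :: "'a mtc_data \<Rightarrow> 'a \<Rightarrow> 'a \<Rightarrow> 'a \<Rightarrow> 'a \<Rightarrow> ('a \<times> nat \<times> nat) set" where
  "right_trees C a b c d =
     {(f, \<mu>, \<nu>). f \<in> anyons C \<and> \<mu> < fus C b c f \<and> \<nu> < fus C a f d}"

definition fusion_rules :: "'a mtc_data \<Rightarrow> bool" where
  "fusion_rules C \<longleftrightarrow>
     finite (anyons C) \<and> vac C \<in> anyons C \<and>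
     (\<forall>a\<in>anyons C. dual C a \<in> anyons C \<and> dual C (dual C a) = a) \<and>
     (\<forall>a\<in>anyons C. \<forall>b\<in>anyons C.
        fus C (vac C) a b = of_bool (a = b) \<and>
        fus C a (vac C) b = of_bool (a = b) \<and>
        fus C a b (vac C) = of_bool (b = dual C a)) \<and>
     (\<forall>a\<in>anyons C. \<forall>b\<in>anyons C. \<forall>c\<in>anyons C. \<forall>d\<in>anyons C.
        (\<Sum>e\<in>anyons C. fus C a b e * fus C e c d) =
        (\<Sum>f\<in>anyons C. fus C b c f * fus C a f d))"

definition F_invertible :: "'a mtc_data \<Rightarrow> bool" where
  "F_invertible C \<longleftrightarrow>
     (\<forall>a\<in>anyons C. \<forall>b\<in>anyons C. \<forall>c\<in>anyons C. \<forall>d\<in>anyons C.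
        invertible_matrix (left_trees C a b c d) (right_trees C a b c d) (Fsym C a b c d))"

definition triangle :: "'a mtc_data \<Rightarrow> bool" where
  "triangle C \<longleftrightarrow>
     (\<forall>a\<in>anyons C. \<forall>b\<in>anyons C. \<forall>c\<in>anyons C. \<forall>\<beta><fus C a b c. \<forall>\<nu><fus C a b c.
        Fsym C a (vac C) b c (a, 0, \<beta>) (b, 0, \<nu>) = of_bool (\<beta> = \<nu>))"

text \<open>
  The two reassociations from \<open>((ab)\<^sub>f\<^sub>,\<^sub>\<alpha> c)\<^sub>g\<^sub>,\<^sub>\<beta> d \<rightarrow> e\<close> (last vertex \<open>\<gamma>\<close>)
  to \<open>a (b (cd)\<^sub>l\<^sub>,\<^sub>\<nu>)\<^sub>k\<^sub>,\<^sub>\<mu> \<rightarrow> e\<close> (last vertex \<open>\<kappa>\<close>).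
\<close>
definition pentagon :: "'a mtc_data \<Rightarrow> bool" where
  "pentagon C \<longleftrightarrow>
     (\<forall>a\<in>anyons C. \<forall>b\<in>anyons C. \<forall>c\<in>anyons C. \<forall>d\<in>anyons C. \<forall>e\<in>anyons C.
      \<forall>f\<in>anyons C. \<forall>g\<in>anyons C. \<forall>k\<in>anyons C. \<forall>l\<in>anyons C.
      \<forall>\<alpha><fus C a b f. \<forall>\<beta><fus C f c g. \<forall>\<gamma><fus C g d e.
      \<forall>\<nu><fus C c d l. \<forall>\<mu><fus C b l k. \<forall>\<kappa><fus C a k e.
        (\<Sum>\<delta><fus C f l e.
           Fsym C f c d e (g, \<beta>, \<gamma>) (l, \<nu>, \<delta>) * Fsym C a b l e (f, \<alpha>, \<delta>) (k, \<mu>, \<kappa>)) =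
        (\<Sum>h\<in>anyons C. \<Sum>\<sigma><fus C b c h. \<Sum>\<psi><fus C a h g. \<Sum>\<rho><fus C h d k.
           Fsym C a b c g (f, \<alpha>, \<beta>) (h, \<sigma>, \<psi>) *
           Fsym C a h d e (g, \<psi>, \<gamma>) (k, \<rho>, \<kappa>) *
           Fsym C b c d k (h, \<sigma>, \<rho>) (l, \<nu>, \<mu>)))"

text \<open>Naturality of the braiding \<open>R\<close> of \<open>a \<otimes> b\<close> past \<open>c\<close>.\<close>
definition hexagon :: "'a mtc_data \<Rightarrow> ('a \<Rightarrow> 'a \<Rightarrow> 'a \<Rightarrow> nat \<Rightarrow> nat \<Rightarrow> complex) \<Rightarrow> bool" where
  "hexagon C R \<longleftrightarrow>
     (\<forall>a\<in>anyons C. \<forall>b\<in>anyons C. \<forall>c\<in>anyons C. \<forall>d\<in>anyons C.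
      \<forall>e\<in>anyons C. \<forall>g\<in>anyons C.
      \<forall>\<alpha><fus C c a e. \<forall>\<beta><fus C e b d. \<forall>\<mu><fus C b c g. \<forall>\<nu><fus C a g d.
        (\<Sum>\<kappa><fus C a c e. \<Sum>\<gamma><fus C c b g.
           R a c e \<alpha> \<kappa> * Fsym C a c b d (e, \<kappa>, \<beta>) (g, \<gamma>, \<nu>) * R b c g \<gamma> \<mu>) =
        (\<Sum>f\<in>anyons C. \<Sum>\<sigma><fus C a b f. \<Sum>\<delta><fus C c f d. \<Sum>\<psi><fus C f c d.
           Fsym C c a b d (e, \<alpha>, \<beta>) (f, \<sigma>, \<delta>) *
           R f c d \<delta> \<psi> *
           Fsym C a b c d (f, \<sigma>, \<psi>) (g, \<mu>, \<nu>)))"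

text \<open>
  \<open>R'\<close> is the matrix of the reverse braiding, \<open>a \<otimes> b \<rightarrow> b \<otimes> a\<close> given by the inverse of the
  braiding of \<open>b\<close> with \<open>a\<close>; the second hexagon axiom is the first one for the reverse braiding.
\<close>
definition braided :: "'a mtc_data \<Rightarrow> bool" where
  "braided C \<longleftrightarrow>
     hexagon C (Rsym C) \<and>
     (\<exists>R'. (\<forall>a\<in>anyons C. \<forall>b\<in>anyons C. \<forall>c\<in>anyons C.
              inverse_matrices {..<fus C b a c} {..<fus C a b c} (Rsym C a b c) (R' b a c)) \<and>
           hexagon C R')"

definition rigid :: "'a mtc_data \<Rightarrow> bool" where
  "rigid C \<longleftrightarrow>
     (\<forall>a\<in>anyons C. Fsym C a (dual C a) a a (vac C, 0, 0) (vac C, 0, 0) \<noteq> 0)"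

text \<open>
  With evaluations \<open>v\<^sup>a\<^sup>*\<^sup>a\<^sub>1\<close>, the double dual of \<open>a\<close> is \<open>a\<close> and a pivotal structure
  \<open>a \<rightarrow> a\<^sup>*\<^sup>*\<close> is a scalar \<open>piv a\<close>. It is monoidal iff rotating \<open>Hom((a \<otimes> b) \<otimes> c, 1)\<close> by a full
  turn is multiplication by \<open>piv a * piv b * piv c\<close>.
\<close>
definition pivotal :: "'a mtc_data \<Rightarrow> bool" where
  "pivotal C \<longleftrightarrow>
     piv C (vac C) = 1 \<and>
     (\<forall>a\<in>anyons C. piv C a \<in> {1, -1}) \<and>
     (\<forall>a\<in>anyons C. \<forall>b\<in>anyons C. \<forall>c\<in>anyons C.
      \<forall>\<alpha><fus C a b (dual C c). \<forall>\<beta><fus C a b (dual C c).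
        (\<Sum>\<mu><fus C b c (dual C a). \<Sum>\<nu><fus C c a (dual C b).
           Fsym C a b c (vac C) (dual C c, \<alpha>, 0) (dual C a, \<mu>, 0) *
           Fsym C b c a (vac C) (dual C a, \<mu>, 0) (dual C b, \<nu>, 0) *
           Fsym C c a b (vac C) (dual C b, \<nu>, 0) (dual C c, \<beta>, 0)) =
        of_int (piv C a * piv C b * piv C c) * of_bool (\<alpha> = \<beta>))"

definition qdim :: "'a mtc_data \<Rightarrow> 'a \<Rightarrow> complex" where
  "qdim C a = of_int (piv C a) / Fsym C a (dual C a) a a (vac C, 0, 0) (vac C, 0, 0)"

text \<open>
  This also constrains the relative scaling of the bases of \<open>Hom(a \<otimes> a\<^sup>*, 1)\<close> and
  \<open>Hom(a\<^sup>* \<otimes> a, 1)\<close>: a spherical structure has coefficients \<open>\<plusminus>1\<close> only if these are compatible.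
\<close>
definition spherical :: "'a mtc_data \<Rightarrow> bool" where
  "spherical C \<longleftrightarrow> (\<forall>a\<in>anyons C. qdim C (dual C a) = qdim C a)"

text \<open>The (unnormalized) \<open>S\<close>-matrix: the quantum trace of the double braiding on \<open>a \<otimes> b\<close>.\<close>
definition Smat :: "'a mtc_data \<Rightarrow> 'a \<Rightarrow> 'a \<Rightarrow> complex" where
  "Smat C a b =
     (\<Sum>c\<in>anyons C. qdim C c *
        (\<Sum>\<mu><fus C a b c. \<Sum>\<nu><fus C b a c. Rsym C b a c \<mu> \<nu> * Rsym C a b c \<nu> \<mu>))"

definition nondegenerate_braiding :: "'a mtc_data \<Rightarrow> bool" where
  "nondegenerate_braiding C \<longleftrightarrow> invertible_matrix (anyons C) (anyons C) (Smat C)"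

definition mtc :: "'a mtc_data \<Rightarrow> bool" where
  "mtc C \<longleftrightarrow>
     fusion_rules C \<and> F_invertible C \<and> triangle C \<and> pentagon C \<and> rigid C \<and>
     pivotal C \<and> spherical C \<and> braided C \<and> nondegenerate_braiding C"

section \<open>Prime categories\<close>

text \<open>A fusion subcategory is identified with the set of its anyons.\<close>
definition fusion_subcategory :: "'a mtc_data \<Rightarrow> 'a set \<Rightarrow> bool" where
  "fusion_subcategory C B \<longleftrightarrow>
     B \<subseteq> anyons C \<and> vac C \<in> B \<and> (\<forall>a\<in>B. dual C a \<in> B) \<and>
     (\<forall>a\<in>B. \<forall>b\<in>B. \<forall>c\<in>anyons C. fus C a b c \<noteq> 0 \<longrightarrow> c \<in> B)"

definition modular_subcategory :: "'a mtc_data \<Rightarrow> 'a set \<Rightarrow> bool" where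
  "modular_subcategory C B \<longleftrightarrow>
     fusion_subcategory C B \<and> nondegenerate_braiding (C\<lparr>anyons := B\<rparr>)"

definition prime_mtc :: "'a mtc_data \<Rightarrow> bool" where
  "prime_mtc C \<longleftrightarrow>
     mtc C \<and> (\<forall>B. modular_subcategory C B \<longrightarrow> B = {vac C} \<or> B = anyons C)"

section \<open>The defining number field and the Galois action\<close>

abbreviation complex_ring :: "complex ring" where
  "complex_ring \<equiv> ring_of_type_algebra"

definition number_field :: "complex set \<Rightarrow> bool" where
  "number_field K \<longleftrightarrow>
     subfield K complex_ring \<and> ring.finite_dimension complex_ring \<rat> K"

definition normal_over_rat :: "complex set \<Rightarrow> bool" where
  "normal_over_rat K \<longleftrightarrow>
     (\<forall>x\<in>K. algebraic x) \<and>
     (\<forall>p :: rat poly. Factorial_Ring.irreducible p \<longrightarrow>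
        (\<exists>x\<in>K. poly (map_poly of_rat p) x = 0) \<longrightarrow>
        (\<forall>y. poly (map_poly of_rat p) y = 0 \<longrightarrow> y \<in> K))"

definition normal_closure :: "complex set \<Rightarrow> complex set" where
  "normal_closure L =
     \<Inter> {K. subfield K complex_ring \<and> normal_over_rat K \<and> L \<subseteq> K}"

definition symbols :: "'a mtc_data \<Rightarrow> complex set" where
  "symbols C =
     {Fsym C a b c d s t | a b c d s t.
        a \<in> anyons C \<and> b \<in> anyons C \<and> c \<in> anyons C \<and> d \<in> anyons C \<and>
        s \<in> left_trees C a b c d \<and> t \<in> right_trees C a b c d} \<union>
     {Rsym C a b c \<mu> \<nu> | a b c \<mu> \<nu>.
        a \<in> anyons C \<and> b \<in> anyons C \<and> c \<in> anyons C \<and>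
        \<mu> < fus C b a c \<and> \<nu> < fus C a b c}"

definition number_field_gauge :: "'a mtc_data \<Rightarrow> bool" where
  "number_field_gauge C \<longleftrightarrow> (\<exists>K. number_field K \<and> symbols C \<subseteq> K)"

definition defining_field :: "'a mtc_data \<Rightarrow> complex set" where
  "defining_field C = normal_closure (generate_field complex_ring (symbols C))"

text \<open>Ring automorphisms of a subfield of the complex numbers fix the rationals.\<close>
definition Gal :: "'a mtc_data \<Rightarrow> (complex \<Rightarrow> complex) set" where
  "Gal C =
     ring_iso (complex_ring\<lparr>carrier := defining_field C\<rparr>)
              (complex_ring\<lparr>carrier := defining_field C\<rparr>)"

definition galois_conj :: "(complex \<Rightarrow> complex) \<Rightarrow> 'a mtc_data \<Rightarrow> 'a mtc_data" where
  "galois_conj q C =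
     C\<lparr>Fsym := \<lambda>a b c d s t. q (Fsym C a b c d s t),
       Rsym := \<lambda>a b c \<mu> \<nu>. q (Rsym C a b c \<mu> \<nu>)\<rparr>"

section \<open>TQFTs\<close>

text \<open>A TQFT is a category with a choice of the sign of the total quantum dimension.\<close>
type_synonym 'a tqft_data = "'a mtc_data \<times> int"

definition total_qdim :: "'a tqft_data \<Rightarrow> complex" where
  "total_qdim T = of_int (snd T) * csqrt (\<Sum>a\<in>anyons (fst T). (qdim (fst T) a)\<^sup>2)"

definition tqft :: "'a tqft_data \<Rightarrow> bool" where
  "tqft T \<longleftrightarrow> mtc (fst T) \<and> snd T \<in> {1, -1}"

definition prime_tqft :: "'a tqft_data \<Rightarrow> bool" where
  "prime_tqft T \<longleftrightarrow> tqft T \<and> prime_mtc (fst T)"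

definition galois_conj_tqft :: "(complex \<Rightarrow> complex) \<Rightarrow> 'a tqft_data \<Rightarrow> 'a tqft_data" where
  "galois_conj_tqft q T = (galois_conj q (fst T), snd T)"

end

theory Submission
  imports Defs
begin

text \<open>
  All axioms of a modular tensor category, as well as the entries of \<open>S\<close>, are polynomial
  expressions in the symbols and in inverses of matrices of symbols. Inverses of matrices over a
  subfield have entries in this subfield, so an automorphism of the subfield carries a modular
  tensor category to a modular tensor category and, as its inverse does the same, neither creates
  nor destroys modular subcategories.
\<close>

section \<open>Isomorphisms of subfields\<close>

text \<open>
  An isomorphism of subfields of \<open>\<complex>\<close> is represented by its graph. In this form a polynomial
  identity is transported by structural introduction rules, and inversion is taking the converse.
\<close>
locale subfield_iso =
  fixes rel :: "complex \<Rightarrow> complex \<Rightarrow> bool"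
  assumes rel_one: "rel 1 1"
    and rel_diff: "rel x x' \<Longrightarrow> rel y y' \<Longrightarrow> rel (x - y) (x' - y')"
    and rel_mult: "rel x x' \<Longrightarrow> rel y y' \<Longrightarrow> rel (x * y) (x' * y')"
    and rel_inverse: "rel x x' \<Longrightarrow> rel (inverse x) (inverse x')"
    and rel_zero_iff: "rel x x' \<Longrightarrow> x = 0 \<longleftrightarrow> x' = 0"
begin

section \<open>Field arithmetic along an isomorphism\<close>

lemma rel_zero: "rel 0 0"
  using rel_diff[OF rel_one rel_one] by simp

lemma rel_uminus: "rel x x' \<Longrightarrow> rel (- x) (- x')"
  using rel_diff[OF rel_zero] by simp

lemma rel_add: "rel x x' \<Longrightarrow> rel y y' \<Longrightarrow> rel (x + y) (x' + y')"
  using rel_diff[OF _ rel_uminus] by fastforce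

lemma rel_divide: "rel x x' \<Longrightarrow> rel y y' \<Longrightarrow> rel (x / y) (x' / y')"
  by (simp add: divide_inverse rel_mult rel_inverse)

lemma rel_sum: "(\<And>i. i \<in> A \<Longrightarrow> rel (f i) (g i)) \<Longrightarrow> rel (sum f A) (sum g A)"
  by (induction A rule: infinite_finite_induct) (auto intro: rel_zero rel_add)

lemma rel_of_bool: "rel (of_bool P) (of_bool P)"
  by (auto intro: rel_zero rel_one)

lemma rel_of_nat: "rel (of_nat n) (of_nat n)"
  by (induction n) (auto intro: rel_zero rel_one rel_add)

lemma rel_of_int: "rel (of_int n) (of_int n)"
  by (cases n rule: int_cases2) (auto intro: rel_of_nat rel_uminus)

text \<open>This is \<open>rel_zero_iff\<close> for the difference. It makes \<open>rel\<close> both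
  single-valued and injective, so equational axioms transport as equivalences.\<close>

lemma rel_eq_iff: "rel x x' \<Longrightarrow> rel y y' \<Longrightarrow> x = y \<longleftrightarrow> x' = y'"
  using rel_zero_iff[OF rel_diff] by simp

text \<open>The locale assumptions are symmetric in the two sides. One-way transport results thereby
  also yield their converses.\<close>

lemma subfield_iso_converse: "subfield_iso rel\<inverse>\<inverse>"
  by unfold_locales
    (auto intro: rel_one rel_diff rel_mult rel_inverse dest: rel_zero_iff)

section \<open>Linear systems and inverse matrices over the source field
  \<open>Domainp rel\<close>\<close>

lemma Domainp_rel_sum: "(\<And>i. i \<in> A \<Longrightarrow> Domainp rel (f i)) \<Longrightarrow> Domainp rel (sum f A)"
  by (induction A rule: infinite_finite_induct) (auto intro: rel_zero rel_add DomainPI)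

lemma Domainp_rel_diff: "Domainp rel x \<Longrightarrow> Domainp rel y \<Longrightarrow> Domainp rel (x - y)"
  by (meson Domainp.simps rel_diff)

lemma Domainp_rel_mult: "Domainp rel x \<Longrightarrow> Domainp rel y \<Longrightarrow> Domainp rel (x * y)"
  by (meson Domainp.simps rel_mult)

lemma Domainp_rel_divide: "Domainp rel x \<Longrightarrow> Domainp rel y \<Longrightarrow> Domainp rel (x / y)"
  by (meson Domainp.simps rel_divide)

text \<open>Gaussian elimination, one unknown at a time: it uses only field operations on the
  coefficients, so a system over the source field that is solvable over the complex numbers is
  solvable over the source field.\<close>

lemma linear_system_descends:
  assumes "finite J"
    and "\<And>i j. i \<in> I \<Longrightarrow> j \<in> J \<Longrightarrow> Domainp rel (M i j)"
    and "\<And>i. i \<in> I \<Longrightarrow> Domainp rel (b i)"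
    and "\<And>i. i \<in> I \<Longrightarrow> (\<Sum>j\<in>J. M i j * x j) = b i"
  obtains y where "\<And>j. j \<in> J \<Longrightarrow> Domainp rel (y j)"
    and "\<And>i. i \<in> I \<Longrightarrow> (\<Sum>j\<in>J. M i j * y j) = b i"
proof -
  have "\<exists>y. (\<forall>j\<in>J. Domainp rel (y j)) \<and> (\<forall>i\<in>I. (\<Sum>j\<in>J. M i j * y j) = b i)"
    using assms
  proof (induction J arbitrary: M b rule: finite_induct)
    case empty
    then show ?case by auto
  next
    case (insert k J)
    note M = insert.prems(1) and b = insert.prems(2)
    have x: "M i k * x k + (\<Sum>j\<in>J. M i j * x j) = b i" if "i \<in> I" for i
      using insert.prems(3)[OF that] insert.hyps by simp
    show ?case
    proof (cases "\<exists>i0\<in>I. M i0 k \<noteq> 0")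
      \<comment> \<open>Column \<open>k\<close> vanishes, so unknown \<open>k\<close> is free and
        can be set to 0.\<close>
      case False
      then obtain y where "\<forall>j\<in>J. Domainp rel (y j)" "\<forall>i\<in>I. (\<Sum>j\<in>J. M i j * y j) = b i"
        using insert.IH[of M b] M b x by auto
      moreover have "(\<Sum>j\<in>J. M i j * (y(k := 0)) j) = (\<Sum>j\<in>J. M i j * y j)" for i
        using insert.hyps by (intro sum.cong) auto
      moreover have "Domainp rel 0"
        using rel_zero by auto
      ultimately show ?thesis
        using insert.hyps by (intro exI[of _ "y(k := 0)"]) auto
    next
      case True
      then obtain i0 where i0: "i0 \<in> I" "M i0 k \<noteq> 0" by blast
      \<comment> \<open>Subtracting \<open>c i\<close> times the pivot row \<open>i0\<close> clears
        column \<open>k\<close> from row \<open>i\<close>; the pivot row itself becomes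
        zero.\<close>
      define c where "c i = M i k / M i0 k" for i
      have c: "Domainp rel (c i)" if "i \<in> I" for i
        unfolding c_def using that i0 M by (intro Domainp_rel_divide) auto
      have row: "(\<Sum>j\<in>J. (M i j - c i * M i0 j) * z j) =
          (\<Sum>j\<in>J. M i j * z j) - c i * (\<Sum>j\<in>J. M i0 j * z j)" for i z
        by (simp add: left_diff_distrib sum_subtractf sum_distrib_left mult.assoc)
      have elim: "(\<Sum>j\<in>J. (M i j - c i * M i0 j) * x j) = b i - c i * b i0" if "i \<in> I" for i
        unfolding row using x[OF that, symmetric] x[OF i0(1), symmetric] i0(2)
        by (simp add: c_def field_simps)
      have "\<exists>y. (\<forall>j\<in>J. Domainp rel (y j)) \<and>
          (\<forall>i\<in>I. (\<Sum>j\<in>J. (M i j - c i * M i0 j) * y j) = b i - c i * b i0)"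
        using i0 M b c elim
        by (intro insert.IH) (simp_all add: Domainp_rel_diff Domainp_rel_mult)
      then obtain y where y: "\<forall>j\<in>J. Domainp rel (y j)"
        and My: "\<forall>i\<in>I. (\<Sum>j\<in>J. M i j * y j) - c i * (\<Sum>j\<in>J. M i0 j * y j) = b i - c i * b i0"
        unfolding row by blast
      \<comment> \<open>Back substitution: \<open>t\<close> is the value of unknown \<open>k\<close>
        dictated by the pivot row.\<close>
      define t where "t = (b i0 - (\<Sum>j\<in>J. M i0 j * y j)) / M i0 k"
      have t: "Domainp rel t"
        unfolding t_def using i0 M b y
        by (intro Domainp_rel_divide Domainp_rel_diff Domainp_rel_sum Domainp_rel_mult) auto
      have "M i k * t + (\<Sum>j\<in>J. M i j * y j) = b i" if "i \<in> I" for i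
        using bspec[OF My that] i0(2) by (simp add: t_def c_def field_simps)
      moreover have "(\<Sum>j\<in>J. M i j * (y(k := t)) j) = (\<Sum>j\<in>J. M i j * y j)" for i
        using insert.hyps by (intro sum.cong) auto
      ultimately show ?thesis
        using insert.hyps y t by (intro exI[of _ "y(k := t)"]) auto
    qed
  qed
  then show ?thesis using that by blast
qed

text \<open>On the source field this is the isomorphism as a function, by single-valuedness of
  \<open>rel\<close>; elsewhere the value is arbitrary.\<close>

definition target :: "complex \<Rightarrow> complex" where
  "target x = (SOME y. rel x y)"

lemma rel_target: "Domainp rel x \<Longrightarrow> rel x (target x)"
  unfolding target_def by (rule someI_ex) auto

text \<open>Column \<open>i\<close> of \<open>N\<close> solves \<open>M y = e_i\<close>. This system
  also has a solution over the source field, and the left inverse property of \<open>N\<close>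
  forces the two to coincide.\<close>

lemma rel_inverse_matrix:
  assumes fin: "finite I" "finite J"
    and rel: "\<And>i j. i \<in> I \<Longrightarrow> j \<in> J \<Longrightarrow> rel (M i j) (M' i j)"
    and inv: "inverse_matrices I J M N"
    and "i \<in> I" "j \<in> J"
  shows "rel (N j i) (target (N j i))"
proof (rule rel_target)
  obtain y where y: "\<And>j. j \<in> J \<Longrightarrow> Domainp rel (y j)"
    and My: "\<And>i'. i' \<in> I \<Longrightarrow> (\<Sum>j\<in>J. M i' j * y j) = of_bool (i' = i)"
  proof (rule linear_system_descends[of J I M "\<lambda>i'. of_bool (i' = i)" "\<lambda>j. N j i"])
    show "(\<Sum>j\<in>J. M i' j * N j i) = of_bool (i' = i)" if "i' \<in> I" for i'
      using inv that \<open>i \<in> I\<close> by (simp add: inverse_matrices_def)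
    show "Domainp rel (M i' j')" if "i' \<in> I" "j' \<in> J" for i' j'
      using rel[OF that] by (rule DomainPI)
    show "Domainp rel (of_bool (i' = i))" for i'
      by (rule DomainPI, rule rel_of_bool)
  qed (use fin in auto)
  \<comment> \<open>The chain computes \<open>N e_i = N (M y) = (N M) y = y\<close> in coordinate
    \<open>j\<close>.\<close>
  have "N j i = (\<Sum>i'\<in>I. N j i' * of_bool (i' = i))"
    using fin \<open>i \<in> I\<close> by (simp add: of_bool_def if_distrib cong: if_cong)
  also have "\<dots> = (\<Sum>i'\<in>I. N j i' * (\<Sum>j'\<in>J. M i' j' * y j'))"
    using My by simp
  also have "\<dots> = (\<Sum>i'\<in>I. \<Sum>j'\<in>J. N j i' * M i' j' * y j')"
    by (simp add: sum_distrib_left mult.assoc)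
  also have "\<dots> = (\<Sum>j'\<in>J. (\<Sum>i'\<in>I. N j i' * M i' j') * y j')"
    by (subst sum.swap) (simp add: sum_distrib_right)
  also have "\<dots> = (\<Sum>j'\<in>J. of_bool (j = j') * y j')"
    using inv \<open>j \<in> J\<close> by (simp add: inverse_matrices_def)
  also have "\<dots> = y j"
    using fin \<open>j \<in> J\<close> by (simp add: of_bool_def if_distrib[where f = "\<lambda>z. z * _"] cong: if_cong)
  finally show "Domainp rel (N j i)"
    using y \<open>j \<in> J\<close> by simp
qed

lemma inverse_matrices_cong_rel:
  assumes "\<And>i j. i \<in> I \<Longrightarrow> j \<in> J \<Longrightarrow> rel (M i j) (M' i j)"
    and "\<And>i j. i \<in> I \<Longrightarrow> j \<in> J \<Longrightarrow> rel (N j i) (N' j i)"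
  shows "inverse_matrices I J M N \<longleftrightarrow> inverse_matrices I J M' N'"
  unfolding inverse_matrices_def
  by (intro conj_cong ball_cong refl rel_eq_iff rel_sum rel_mult rel_of_bool assms)

lemma inverse_matrices_image:
  assumes "finite I" "finite J"
    and "\<And>i j. i \<in> I \<Longrightarrow> j \<in> J \<Longrightarrow> rel (M i j) (M' i j)"
    and "inverse_matrices I J M N"
  shows "inverse_matrices I J M' (\<lambda>j i. target (N j i))"
  using inverse_matrices_cong_rel[of I J M M' N "\<lambda>j i. target (N j i)"]
    rel_inverse_matrix[OF assms] assms(3,4) by blast

lemma invertible_matrix_image:
  assumes "finite I" "finite J"
    and "\<And>i j. i \<in> I \<Longrightarrow> j \<in> J \<Longrightarrow> rel (M i j) (M' i j)"
    and "invertible_matrix I J M"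
  shows "invertible_matrix I J M'"
  using inverse_matrices_image[where M = M and M' = M', OF assms(1-3)] assms(4)
  unfolding invertible_matrix_def by blast

lemma invertible_matrix_cong_rel:
  assumes "finite I" "finite J"
    and "\<And>i j. i \<in> I \<Longrightarrow> j \<in> J \<Longrightarrow> rel (M i j) (M' i j)"
  shows "invertible_matrix I J M \<longleftrightarrow> invertible_matrix I J M'"
  using invertible_matrix_image[OF assms]
    subfield_iso.invertible_matrix_image[OF subfield_iso_converse, of I J M' M] assms by auto

end

section \<open>Subfields of the complex numbers in ordinary arithmetic\<close>

lemma a_inv_complex_ring: "\<ominus>\<^bsub>complex_ring\<^esub> x = - x"
proof -
  interpret field complex_ring by (rule field_from_type_algebra)
  show ?thesis
    by (rule minus_equality) (simp_all add: ring_of_type_algebra_def)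
qed

lemma m_inv_complex_ring: "x \<noteq> 0 \<Longrightarrow> inv\<^bsub>complex_ring\<^esub> x = inverse x"
proof -
  interpret field complex_ring by (rule field_from_type_algebra)
  show "x \<noteq> 0 \<Longrightarrow> inv\<^bsub>complex_ring\<^esub> x = inverse x"
    by (rule comm_inv_char) (simp_all add: ring_of_type_algebra_def)
qed

text \<open>Since \<open>inverse 0 = 0\<close>, closure under inverses can be stated without
  excluding zero. Closure conditions of this kind visibly pass to intersections.\<close>

lemma subfield_complex_ring_iff:
  "subfield K complex_ring \<longleftrightarrow>
     1 \<in> K \<and> (\<forall>x\<in>K. \<forall>y\<in>K. x - y \<in> K) \<and> (\<forall>x\<in>K. \<forall>y\<in>K. x * y \<in> K) \<and> (\<forall>x\<in>K. inverse x \<in> K)"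
proof
  interpret field complex_ring by (rule field_from_type_algebra)
  {
    assume K: "subfield K complex_ring"
    note [simp] = ring_of_type_algebra_def
    note R = subringE[OF subfieldE(1)[OF K]]
    have zero: "0 \<in> K" and one: "1 \<in> K"
      using R(2,3) by simp_all
    have minus: "- x \<in> K" if "x \<in> K" for x
      using R(5)[OF that] by (simp only: a_inv_complex_ring)
    have add: "x + y \<in> K" and mult: "x * y \<in> K" if "x \<in> K" "y \<in> K" for x y
      using R(6,7)[OF that] by simp_all
    have "inverse x \<in> K" if "x \<in> K" for x
    proof (cases "x = 0")
      case False
      then have "inv\<^bsub>complex_ring\<^esub> x \<in> K"
        using subfield_m_inv(1)[OF K] that by simp
      then show ?thesis
        by (simp only: m_inv_complex_ring[OF False])
    qed (use zero in simp)
    moreover have "x - y \<in> K" if "x \<in> K" "y \<in> K" for x y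
      using add[OF that(1) minus[OF that(2)]] by simp
    ultimately show "1 \<in> K \<and> (\<forall>x\<in>K. \<forall>y\<in>K. x - y \<in> K) \<and> (\<forall>x\<in>K. \<forall>y\<in>K. x * y \<in> K) \<and>
        (\<forall>x\<in>K. inverse x \<in> K)"
      using one mult by blast
  next
    assume K: "1 \<in> K \<and> (\<forall>x\<in>K. \<forall>y\<in>K. x - y \<in> K) \<and> (\<forall>x\<in>K. \<forall>y\<in>K. x * y \<in> K) \<and>
        (\<forall>x\<in>K. inverse x \<in> K)"
    then have zero: "0 \<in> K"
      by (metis diff_self)
    then have minus: "- x \<in> K" if "x \<in> K" for x
      using K that by (metis diff_0)
    then have add: "x + y \<in> K" if "x \<in> K" "y \<in> K" for x y
      using K that by (metis diff_minus_eq_add)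
    show "subfield K complex_ring"
    proof (rule subfieldI')
      show "subring K complex_ring"
      proof (rule subringI)
        show "\<ominus>\<^bsub>complex_ring\<^esub> x \<in> K" if "x \<in> K" for x
          using minus[OF that] by (simp only: a_inv_complex_ring)
      qed (use K add in \<open>simp_all add: ring_of_type_algebra_def\<close>)
      show "inv\<^bsub>complex_ring\<^esub> x \<in> K" if "x \<in> K - {\<zero>\<^bsub>complex_ring\<^esub>}" for x
      proof -
        have "x \<in> K" "x \<noteq> 0"
          using that by (simp_all add: ring_of_type_algebra_def)
        then show ?thesis
          using K by (simp add: m_inv_complex_ring)
      qed
    qed
  }
qed

lemma subfield_iso_graph:
  assumes "subfield K complex_ring"
    and q: "q \<in> ring_iso (complex_ring\<lparr>carrier := K\<rparr>) (complex_ring\<lparr>carrier := L\<rparr>)"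
  shows "subfield_iso (\<lambda>x y. x \<in> K \<and> y = q x)"
proof -
  have K: "1 \<in> K" "\<And>x y. x \<in> K \<Longrightarrow> y \<in> K \<Longrightarrow> x - y \<in> K" "\<And>x y. x \<in> K \<Longrightarrow> y \<in> K \<Longrightarrow> x * y \<in> K"
      "\<And>x. x \<in> K \<Longrightarrow> inverse x \<in> K"
    using assms(1) by (simp_all add: subfield_complex_ring_iff)
  have zero: "0 \<in> K"
    using K(2)[OF K(1) K(1)] by simp
  have one: "q 1 = 1" and inj: "inj_on q K"
    and add: "\<And>x y. x \<in> K \<Longrightarrow> y \<in> K \<Longrightarrow> q (x + y) = q x + q y"
    and mult: "\<And>x y. x \<in> K \<Longrightarrow> y \<in> K \<Longrightarrow> q (x * y) = q x * q y"
    using q by (auto simp: ring_iso_def ring_hom_def ring_of_type_algebra_def bij_betw_def)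
  \<comment> \<open>A ring homomorphism is given as additive; compatibility with subtraction comes
    from \<open>x = (x - y) + y\<close>.\<close>
  have diff: "q (x - y) = q x - q y" if "x \<in> K" "y \<in> K" for x y
    using add[of "x - y" y] that K(2) by simp
  then have q0: "q 0 = 0"
    using zero by force
  have inv: "q (inverse x) = inverse (q x)" if "x \<in> K" for x
  proof (cases "x = 0")
    case False
    then have "q x * q (inverse x) = 1"
      using mult[OF that K(4)[OF that]] one by simp
    then show ?thesis
      by (simp add: inverse_unique)
  qed (use q0 in simp)
  \<comment> \<open>Injectivity of \<open>q\<close> on \<open>K\<close> excludes a nonzero element
    with image 0.\<close>
  have "x = 0 \<longleftrightarrow> q x = 0" if "x \<in> K" for x
    using inj_onD[OF inj _ that zero] q0 by auto
  then show ?thesis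
    by unfold_locales (simp_all add: K one diff mult inv)
qed

section \<open>Transport of the axioms\<close>

text \<open>Only symbols with indices in range are related, because the remaining values are
  meaningless and may lie outside the source field. The fusion rules serve to verify that the
  indices occurring in the axioms are in range.\<close>

locale related_mtc_data = subfield_iso rel
  for rel :: "complex \<Rightarrow> complex \<Rightarrow> bool" +
  fixes C D :: "'a mtc_data"
  assumes same: "anyons D = anyons C" "vac D = vac C" "dual D = dual C" "fus D = fus C"
      "piv D = piv C"
    and rel_Fsym: "\<lbrakk>a \<in> anyons C; b \<in> anyons C; c \<in> anyons C; d \<in> anyons C;
        s \<in> left_trees C a b c d; t \<in> right_trees C a b c d\<rbrakk> \<Longrightarrow>
      rel (Fsym C a b c d s t) (Fsym D a b c d s t)"
    and rel_Rsym: "\<lbrakk>a \<in> anyons C; b \<in> anyons C; c \<in> anyons C;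
        \<mu> < fus C b a c; \<nu> < fus C a b c\<rbrakk> \<Longrightarrow>
      rel (Rsym C a b c \<mu> \<nu>) (Rsym D a b c \<mu> \<nu>)"
    and fusion_rules: "fusion_rules C"
begin

lemma fusion_rulesD:
  "finite (anyons C)" "vac C \<in> anyons C"
  "a \<in> anyons C \<Longrightarrow> dual C a \<in> anyons C" "a \<in> anyons C \<Longrightarrow> dual C (dual C a) = a"
  "a \<in> anyons C \<Longrightarrow> b \<in> anyons C \<Longrightarrow> fus C (vac C) a b = of_bool (a = b)"
  "a \<in> anyons C \<Longrightarrow> b \<in> anyons C \<Longrightarrow> fus C a (vac C) b = of_bool (a = b)"
  "a \<in> anyons C \<Longrightarrow> b \<in> anyons C \<Longrightarrow> fus C a b (vac C) = of_bool (b = dual C a)"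
  using fusion_rules by (auto simp: fusion_rules_def)

lemma trees_same: "left_trees D = left_trees C" "right_trees D = right_trees C"
  by (auto simp: left_trees_def right_trees_def same fun_eq_iff)

lemma finite_trees: "finite (left_trees C a b c d)" "finite (right_trees C a b c d)"
proof -
  have "left_trees C a b c d = (SIGMA e:anyons C. {..<fus C a b e} \<times> {..<fus C e c d})"
    by (auto simp: left_trees_def)
  then show "finite (left_trees C a b c d)" using fusion_rulesD(1) by simp
  have "right_trees C a b c d = (SIGMA f:anyons C. {..<fus C b c f} \<times> {..<fus C a f d})"
    by (auto simp: right_trees_def)
  then show "finite (right_trees C a b c d)" using fusion_rulesD(1) by simp
qed

text \<open>These rules follow an axiom through its quantifiers, sums and products down to single
  symbols. What remains are the range conditions, settled by \<open>tree_simps\<close>.\<close>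

lemmas rel_intros = ball_cong all_cong refl rel_eq_iff rel_sum rel_mult rel_of_bool rel_of_int
  rel_Fsym rel_Rsym

lemmas tree_simps = left_trees_def right_trees_def fusion_rulesD

lemma fusion_rules_iff: "fusion_rules D \<longleftrightarrow> fusion_rules C"
  by (simp add: fusion_rules_def same)

lemma F_invertible_iff: "F_invertible C \<longleftrightarrow> F_invertible D"
  unfolding F_invertible_def same trees_same
  by (intro ball_cong refl invertible_matrix_cong_rel finite_trees rel_Fsym)

lemma triangle_iff: "triangle C \<longleftrightarrow> triangle D"
  unfolding triangle_def same by (intro rel_intros) (simp_all add: tree_simps)

lemma pentagon_iff: "pentagon C \<longleftrightarrow> pentagon D"
  unfolding pentagon_def same by (intro rel_intros) (simp_all add: tree_simps)

text \<open>The matrices \<open>R\<close> and \<open>R'\<close> are left general so that the result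
  covers both the braiding and the reverse braiding.\<close>

lemma hexagon_iff:
  assumes "\<And>a b c \<mu> \<nu>. \<lbrakk>a \<in> anyons C; b \<in> anyons C; c \<in> anyons C;
        \<mu> < fus C b a c; \<nu> < fus C a b c\<rbrakk> \<Longrightarrow> rel (R a b c \<mu> \<nu>) (R' a b c \<mu> \<nu>)"
  shows "hexagon C R \<longleftrightarrow> hexagon D R'"
  unfolding hexagon_def same by (intro rel_intros assms) (simp_all add: tree_simps)

lemma braided_image:
  assumes "braided C"
  shows "braided D"
proof -
  from assms obtain R' where hex: "hexagon C (Rsym C)" "hexagon C R'"
    and inv: "\<And>a b c. \<lbrakk>a \<in> anyons C; b \<in> anyons C; c \<in> anyons C\<rbrakk> \<Longrightarrow>
      inverse_matrices {..<fus C b a c} {..<fus C a b c} (Rsym C a b c) (R' b a c)"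
    unfolding braided_def by blast
  \<comment> \<open>The reverse braiding of \<open>D\<close> is the entrywise image of that of
    \<open>C\<close>.\<close>
  define R'' where "R'' = (\<lambda>a b c \<mu> \<nu>. target (R' a b c \<mu> \<nu>))"
  have "hexagon D (Rsym D)"
    using hexagon_iff[of "Rsym C" "Rsym D"] hex rel_Rsym by blast
  moreover have "hexagon D R''"
  proof (rule iffD1[OF hexagon_iff hex(2)])
    fix a b c \<mu> \<nu>
    assume "a \<in> anyons C" "b \<in> anyons C" "c \<in> anyons C" "\<mu> < fus C b a c" "\<nu> < fus C a b c"
    then show "rel (R' a b c \<mu> \<nu>) (R'' a b c \<mu> \<nu>)"
      unfolding R''_def
      \<comment> \<open>The labels are swapped because \<open>R' a b c\<close> inverts
        \<open>Rsym C b a c\<close>; hence its entries lie in the source field.\<close>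
      by (intro rel_inverse_matrix[where M' = "Rsym D b a c", OF _ _ _ inv[of b a c]] rel_Rsym) auto
  qed
  moreover have "inverse_matrices {..<fus C b a c} {..<fus C a b c} (Rsym D a b c) (R'' b a c)"
    if "a \<in> anyons C" "b \<in> anyons C" "c \<in> anyons C" for a b c
    unfolding R''_def using that by (intro inverse_matrices_image[OF _ _ _ inv] rel_Rsym) auto
  ultimately show ?thesis
    unfolding braided_def same by blast
qed

text \<open>The indices are in range since \<open>a\<close> and \<open>dual C a\<close> fuse to the
  vacuum with multiplicity one, in either order. This symbol governs both rigidity and quantum
  dimensions.\<close>

lemma rel_Fsym_loop:
  "a \<in> anyons C \<Longrightarrow>
    rel (Fsym C a (dual C a) a a (vac C, 0, 0) (vac C, 0, 0))
      (Fsym D a (dual C a) a a (vac C, 0, 0) (vac C, 0, 0))"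
  by (rule rel_Fsym) (simp_all add: tree_simps)

lemma rigid_iff: "rigid C \<longleftrightarrow> rigid D"
  unfolding rigid_def same using rel_zero_iff[OF rel_Fsym_loop] by blast

lemma pivotal_iff: "pivotal C \<longleftrightarrow> pivotal D"
  unfolding pivotal_def same
  by (intro conj_cong rel_intros) (simp_all add: tree_simps)

section \<open>Quantum dimensions, the \<open>S\<close>-matrix and modular subcategories\<close>

lemma rel_qdim: "a \<in> anyons C \<Longrightarrow> rel (qdim C a) (qdim D a)"
  unfolding qdim_def same by (intro rel_divide rel_of_int rel_Fsym_loop)

lemma spherical_iff: "spherical C \<longleftrightarrow> spherical D"
  unfolding spherical_def same by (intro rel_intros rel_qdim) (simp_all add: fusion_rulesD)

lemma rel_Smat:
  assumes "B \<subseteq> anyons C" "a \<in> B" "b \<in> B"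
  shows "rel (Smat (C\<lparr>anyons := B\<rparr>) a b) (Smat (D\<lparr>anyons := B\<rparr>) a b)"
proof -
  \<comment> \<open>Passing to a subcategory shortens the sum defining \<open>Smat\<close> but
    leaves the quantum dimensions alone.\<close>
  have "qdim (E\<lparr>anyons := B\<rparr>) c = qdim E c" for c and E :: "'a mtc_data"
    by (simp add: qdim_def)
  then show ?thesis
    using assms by (auto simp: Smat_def same intro!: rel_sum rel_mult rel_Rsym rel_qdim)
qed

lemma nondegenerate_braiding_iff:
  assumes "B \<subseteq> anyons C"
  shows "nondegenerate_braiding (C\<lparr>anyons := B\<rparr>) \<longleftrightarrow> nondegenerate_braiding (D\<lparr>anyons := B\<rparr>)"
proof -
  have "finite B"
    using assms fusion_rulesD(1) finite_subset by blast
  then show ?thesis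
    unfolding nondegenerate_braiding_def
    using invertible_matrix_cong_rel[OF _ _ rel_Smat[OF assms]] by simp
qed

text \<open>Closure under fusion and duals involves only shared data, and nondegeneracy transports
  both ways. Primality of \<open>D\<close> uses the direction from \<open>D\<close> back to
  \<open>C\<close>.\<close>

lemma modular_subcategory_iff: "modular_subcategory C B \<longleftrightarrow> modular_subcategory D B"
  using nondegenerate_braiding_iff[of B]
  unfolding modular_subcategory_def fusion_subcategory_def same by blast

lemma mtc_image: "mtc C \<Longrightarrow> mtc D"
proof -
  \<comment> \<open>The full category is treated as the case \<open>B = anyons C\<close> of the
    result on restrictions.\<close>
  have "C\<lparr>anyons := anyons C\<rparr> = C" "D\<lparr>anyons := anyons C\<rparr> = D"
    using same(1) by simp_all
  then have "nondegenerate_braiding C \<longleftrightarrow> nondegenerate_braiding D"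
    using nondegenerate_braiding_iff[of "anyons C"] by simp
  then show "mtc C \<Longrightarrow> mtc D"
    unfolding mtc_def using fusion_rules_iff F_invertible_iff triangle_iff pentagon_iff rigid_iff
      pivotal_iff spherical_iff braided_image by blast
qed

lemma prime_mtc_image: "prime_mtc C \<Longrightarrow> prime_mtc D"
  unfolding prime_mtc_def using mtc_image modular_subcategory_iff by (simp add: same)

end

section \<open>Galois conjugates\<close>

text \<open>An intersection of subfields inherits the closure conditions.\<close>

lemma subfield_normal_closure: "subfield (normal_closure L) complex_ring"
  unfolding normal_closure_def by (simp add: subfield_complex_ring_iff)

text \<open>The relation is the graph of \<open>q\<close> on the defining field. All symbols in
  range lie in that field, so this graph relates \<open>C\<close> to its conjugate.\<close>

lemma prime_mtc_galois_conj:
  assumes "prime_mtc C" "q \<in> Gal C"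
  shows "prime_mtc (galois_conj q C)"
proof -
  let ?K = "defining_field C"
  have sym: "symbols C \<subseteq> ?K"
    unfolding defining_field_def normal_closure_def by (auto intro: generate_field.incl)
  interpret subfield_iso "\<lambda>x y. x \<in> ?K \<and> y = q x"
    using subfield_iso_graph subfield_normal_closure assms(2)
    unfolding Gal_def defining_field_def by blast
  interpret related_mtc_data "\<lambda>x y. x \<in> ?K \<and> y = q x" C "galois_conj q C"
  proof unfold_locales
    show "fusion_rules C"
      using assms(1) by (simp add: prime_mtc_def mtc_def)
  next
    fix a b c d s t
    assume "a \<in> anyons C" "b \<in> anyons C" "c \<in> anyons C" "d \<in> anyons C"
      "s \<in> left_trees C a b c d" "t \<in> right_trees C a b c d"
    then have "Fsym C a b c d s t \<in> symbols C"
      unfolding symbols_def by blast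
    then show "Fsym C a b c d s t \<in> ?K \<and> Fsym (galois_conj q C) a b c d s t = q (Fsym C a b c d s t)"
      using sym by (auto simp: galois_conj_def)
  next
    fix a b c \<mu> \<nu>
    assume "a \<in> anyons C" "b \<in> anyons C" "c \<in> anyons C" "\<mu> < fus C b a c" "\<nu> < fus C a b c"
    then have "Rsym C a b c \<mu> \<nu> \<in> symbols C"
      unfolding symbols_def by blast
    then show "Rsym C a b c \<mu> \<nu> \<in> ?K \<and> Rsym (galois_conj q C) a b c \<mu> \<nu> = q (Rsym C a b c \<mu> \<nu>)"
      using sym by (auto simp: galois_conj_def)
  qed (simp_all add: galois_conj_def)
  show ?thesis
    using assms(1) by (rule prime_mtc_image)
qed

theorem theorem2p1:
  fixes C :: "'a mtc_data" and q :: "complex \<Rightarrow> complex"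
  assumes "prime_mtc C" and "number_field_gauge C" and "q \<in> Gal C"
  shows "prime_mtc (galois_conj q C) \<and>
         (\<forall>s. prime_tqft (C, s) \<longrightarrow> prime_tqft (galois_conj_tqft q (C, s)))"
proof -
  have "prime_mtc (galois_conj q C)"
    using assms(1,3) by (rule prime_mtc_galois_conj)
  \<comment> \<open>Conjugation keeps the sign \<open>s\<close>, so the claim for TQFTs reduces to
    the one for categories.\<close>
  then show ?thesis
    by (auto simp: prime_tqft_def tqft_def galois_conj_tqft_def prime_mtc_def)
qed

end
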